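(* In the setting of the context, let $f:\mathbb X\to\mathbb R$ be a bounded measurable function, let $N\geqslant1$, $n\in\mathbb N$, and, for $(X_1,\dots,X_N)\sim\mu_n^N$, let \[ \mathfrak R(f,n,N,h)=\mathbb E\Big[\Big(\frac1N\sum_{i=1}^Nf(X_i)-\bar\mu_*(f)\Big)^2\Big]. \] (i) If $N\geqslant2$, then \[ \mathfrak R(f,n,N,h)\leqslant4\|f\|_\infty^2\Big(\frac1N+\sqrt{2\mathcal H(\mu_n^N|\mu_\infty^N)}+\mathrm{TV}(\mu_\infty^{2,N},\bar\mu_*^{\otimes2})\Big), \] where $\mu_\infty^{2,N}$ denotes the law of $(Y_1,Y_2)$ when $(Y_1,\dots,Y_N)\sim\mu_\infty^N$. (ii) Assume that there exist $R>0$ and $(\eta_N)_{N\in\mathbb N}\in\mathbb R_+^{\mathbb N}$ such that, for all $N\in\mathbb N$ and all $\mu\in\mathcal P_2(\mathbb X^N)$, \[ \mathcal H(\mu|\bar\mu_*^{\otimes N})\leqslant R\,\mathcal H(\mu|\mu_\infty^N)+\eta_N. \] Then \[ \mathfrak R(f,n,N,h)\leqslant4\|f\|_\infty^2\Big(\frac1N+2\sqrt{\frac{\eta_N+R\,\mathcal H(\mu_n^N|\mu_\infty^N)}{N}}\Big). \]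
   Context: $\mathbb X=\mathbb R^d$ or $\mathbb X=\mathbb T^d$ ($\mathbb T=\mathbb R/\mathbb Z$); $\mathcal P_2(E)$ is the set of probability measures on $E$ with finite second moment. Relative entropy: $\mathcal H(\nu|\mu)=\int\ln\frac{d\nu}{d\mu}\,d\nu$ ($+\infty$ if $\nu\not\ll\mu$). Total variation: $\mathrm{TV}(\mu,\nu)=\sup_{\|g\|_\infty\leqslant1}|\mu(g)-\nu(g)|$ (total mass of $|\mu-\nu|$). $F:\mathcal P_2(\mathbb X)\to\mathbb R$ is an energy functional with linear derivative $U_\mu(x)=\frac{\delta F}{\delta m}(\mu,x)$, i.e. $F(\mu)-F(\nu)=\int_0^1\int_{\mathbb X}\frac{\delta F}{\delta m}((1-t)\nu+t\mu,x)(\mu-\nu)(dx)dt$. The free energy is $\mathcal F(\mu)=F(\mu)+\int\mu\ln\mu$ ($+\infty$ if $\mu$ has no Lebesgue density). It is assumed that $\mathcal F$ has a unique global minimizer $\bar\mu_*$, which satisfies $\bar\mu_*\propto e^{-U_{\bar\mu_*}}$. For $\mathbf x\in\mathbb X^N$, $\pi_{\mathbf x}=\frac1N\sum_{i=1}^N\delta_{x_i}$ and $U_N(\mathbf x)=NF(\pi_{\mathbf x})$ (assumed differentiable with $e^{-U_N}$ integrable); $\mu_\infty^N$ is the probability measure on $\mathbb X^N$ with density $\propto e^{-U_N}$. Chain: fix $\gamma>0$, $0<h<\gamma^{-1}$, $\eta=1-\gamma h$. The Verlet map is $\Phi(\mathbf x,\mathbf v)=(\bar{\mathbf x},\bar{\mathbf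 v})$ with $\bar{\mathbf x}=\mathbf x+h\mathbf v-\frac{h^2}2\nabla U_N(\mathbf x)$, $\bar{\mathbf v}=\mathbf v-\frac h2(\nabla U_N(\mathbf x)+\nabla U_N(\bar{\mathbf x}))$; $\mathcal Df(\mathbf x,\mathbf v)=\mathbb E[f(\mathbf x,\eta\mathbf v+\sqrt{1-\eta^2}\,\mathbf G)]$ with $\mathbf G\sim\mathcal N(0,I_{dN})$; and $\mathcal Pf=\mathcal D(f\circ\Phi)$. The initial law $\nu_0^N\in\mathcal P_2(\mathbb X^N\times\mathbb R^{dN})$ is such that the $N$ particles $(x_i,v_i)$ are indistinguishable (exchangeable); $\nu_n^N=\nu_0^N\mathcal P^n$ and $\mu_n^N\in\mathcal P_2(\mathbb X^N)$ is the position marginal of $\nu_n^N$ (the law of $\mathbf x$ under $\nu_n^N$). *)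

theory Defs
  imports "HOL-Probability.Probability"
begin

text \<open>
  The one-particle space is either $\mathbb R^d$ or the torus $\mathbb T^d = \mathbb R^d/\mathbb Z^d$,
  with \<open>d = CARD('d)\<close>. A point of the torus is encoded by its representative in $[0,1)^d$. The
  quotient map then becomes reduction modulo 1, the Borel sets of the torus become the Borel subsets
  of $[0,1)^d$, and a function on the torus is differentiated by differentiating its periodic lift
  to $\mathbb R^d$.
\<close>

datatype geometry = Euclidean | Torus

fun states :: "geometry \<Rightarrow> (real ^ 'd::finite) set" where
  "states Euclidean = UNIV"
| "states Torus = {x. \<forall>k. 0 \<le> x $ k \<and> x $ k < 1}"

fun wrap :: "geometry \<Rightarrow> real ^ 'd::finite \<Rightarrow> real ^ 'd" where
  "wrap Euclidean x = x"
| "wrap Torus x = (\<chi> k. frac (x $ k))"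

definition leb :: "geometry \<Rightarrow> (real ^ 'd::finite) measure" where
  "leb g = restrict_space lborel (states g)"

definition lebN :: "geometry \<Rightarrow> nat \<Rightarrow> (nat \<Rightarrow> real ^ 'd::finite) measure" where
  "lebN g N = Pi\<^sub>M {..<N} (\<lambda>_. leb g)"

definition velN :: "nat \<Rightarrow> (nat \<Rightarrow> real ^ 'd::finite) measure" where
  "velN N = Pi\<^sub>M {..<N} (\<lambda>_. borel)"

definition phaseN ::
    "geometry \<Rightarrow> nat \<Rightarrow> ((nat \<Rightarrow> real ^ 'd::finite) \<times> (nat \<Rightarrow> real ^ 'd)) measure" where
  "phaseN g N = lebN g N \<Otimes>\<^sub>M velN N"


text \<open>Probability measures with finite second moment. On the torus the moment condition always
  holds. Only the \<open>\<sigma>\<close>-algebras of \<open>leb g\<close>, \<open>lebN g N\<close>, \<open>phaseN g N\<close> matter here.\<close>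

definition P2 :: "geometry \<Rightarrow> (real ^ 'd::finite) measure set" where
  "P2 g = {\<mu>. prob_space \<mu> \<and> sets \<mu> = sets (leb g) \<and> integrable \<mu> (\<lambda>x. (norm x)\<^sup>2)}"

definition P2N :: "geometry \<Rightarrow> nat \<Rightarrow> (nat \<Rightarrow> real ^ 'd::finite) measure set" where
  "P2N g N = {\<mu>. prob_space \<mu> \<and> sets \<mu> = sets (lebN g N) \<and>
     integrable \<mu> (\<lambda>x. \<Sum>i<N. (norm (x i))\<^sup>2)}"

definition P2_phase ::
    "geometry \<Rightarrow> nat \<Rightarrow> ((nat \<Rightarrow> real ^ 'd::finite) \<times> (nat \<Rightarrow> real ^ 'd)) measure set" where
  "P2_phase g N = {\<nu>. prob_space \<nu> \<and> sets \<nu> = sets (phaseN g N) \<and>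
     integrable \<nu> (\<lambda>(x, v). \<Sum>i<N. (norm (x i))\<^sup>2 + (norm (v i))\<^sup>2)}"


text \<open>\<open>rel_entropy \<nu> \<mu>\<close> is $\mathcal H(\nu|\mu)$; note the argument order of
  \<^const>\<open>KL_divergence\<close>. For probability measures the negative part of $\ln\frac{d\nu}{d\mu}$ is
  always \<open>\<nu>\<close>-integrable, so if the logarithm is not integrable its integral is \<open>+\<infinity>\<close>.\<close>

definition rel_entropy :: "'a measure \<Rightarrow> 'a measure \<Rightarrow> ereal" where
  "rel_entropy \<nu> \<mu> =
     (if absolutely_continuous \<mu> \<nu> \<and> integrable \<nu> (entropy_density (exp 1) \<mu> \<nu>)
      then ereal (KL_divergence (exp 1) \<mu> \<nu>) else \<infinity>)"

definition TV :: "'a measure \<Rightarrow> 'a measure \<Rightarrow> real" where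
  "TV \<mu> \<nu> = (SUP \<phi> \<in> {\<phi> \<in> borel_measurable \<mu>. \<forall>x\<in>space \<mu>. \<bar>\<phi> x\<bar> \<le> 1}.
     \<bar>(\<integral>x. \<phi> x \<partial>\<mu>) - (\<integral>x. \<phi> x \<partial>\<nu>)\<bar>)"

definition sup_norm :: "geometry \<Rightarrow> (real ^ 'd::finite \<Rightarrow> real) \<Rightarrow> real" where
  "sup_norm g f = (SUP x\<in>states g. \<bar>f x\<bar>)"

text \<open>The square root on $[0,\infty]$.\<close>

definition esqrt :: "ereal \<Rightarrow> ereal" where
  "esqrt a = (if a = \<infinity> then \<infinity> else ereal (sqrt (real_of_ereal a)))"


definition mixture :: "real \<Rightarrow> 'a measure \<Rightarrow> 'a measure \<Rightarrow> 'a measure" where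
  "mixture t \<nu> \<mu> = measure_of (space \<nu>) (sets \<nu>)
     (\<lambda>A. ennreal (1 - t) * emeasure \<nu> A + ennreal t * emeasure \<mu> A)"

text \<open>The first conjunct and \<^const>\<open>set_integrable\<close> say that the integrals in the formula are
  meaningful (Bochner integrals of non-integrable functions are 0).\<close>

definition linear_derivative ::
    "geometry \<Rightarrow> ((real ^ 'd::finite) measure \<Rightarrow> real) \<Rightarrow>
     ((real ^ 'd) measure \<Rightarrow> real ^ 'd \<Rightarrow> real) \<Rightarrow> bool" where
  "linear_derivative g F U \<longleftrightarrow> (\<forall>\<mu>\<in>P2 g. \<forall>\<nu>\<in>P2 g.
     (\<forall>t\<in>{0..1}. integrable \<mu> (U (mixture t \<nu> \<mu>)) \<and> integrable \<nu> (U (mixture t \<nu> \<mu>))) \<and>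
     set_integrable lborel {0..1}
       (\<lambda>t. (\<integral>x. U (mixture t \<nu> \<mu>) x \<partial>\<mu>) - (\<integral>x. U (mixture t \<nu> \<mu>) x \<partial>\<nu>)) \<and>
     F \<mu> - F \<nu> =
       (LBINT t:{0..1}. (\<integral>x. U (mixture t \<nu> \<mu>) x \<partial>\<mu>) - (\<integral>x. U (mixture t \<nu> \<mu>) x \<partial>\<nu>)))"

text \<open>For \<open>\<mu> \<in> P2 g\<close> with Lebesgue density \<open>\<rho>\<close> the negative part of \<open>\<rho> ln \<rho>\<close> is integrable, so
  $\int\rho\ln\rho = +\infty$ whenever \<open>\<rho> ln \<rho>\<close> is not integrable.\<close>

definition free_energy ::
    "geometry \<Rightarrow> ((real ^ 'd::finite) measure \<Rightarrow> real) \<Rightarrow> (real ^ 'd) measure \<Rightarrow> ereal" where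
  "free_energy g F \<mu> =
     (let \<rho> = (\<lambda>x. enn2real (RN_deriv (leb g) \<mu> x)) in
      if absolutely_continuous (leb g) \<mu> \<and> integrable (leb g) (\<lambda>x. \<rho> x * ln (\<rho> x))
      then ereal (F \<mu> + (\<integral>x. \<rho> x * ln (\<rho> x) \<partial>leb g)) else \<infinity>)"


text \<open>The empirical measure $\frac1N\sum_{i<N}\delta_{x_i}$, as the law of \<open>x i\<close> for a uniformly
  chosen index \<open>i\<close>.\<close>

definition empirical ::
    "geometry \<Rightarrow> nat \<Rightarrow> (nat \<Rightarrow> real ^ 'd::finite) \<Rightarrow> (real ^ 'd) measure" where
  "empirical g N x = distr (uniform_count_measure {..<N}) (leb g) x"

definition potential ::
    "geometry \<Rightarrow> ((real ^ 'd::finite) measure \<Rightarrow> real) \<Rightarrow> nat \<Rightarrow> (nat \<Rightarrow> real ^ 'd) \<Rightarrow> real" where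
  "potential g F N x = real N * F (empirical g N x)"

definition lift_potential ::
    "geometry \<Rightarrow> ((real ^ 'd::finite) measure \<Rightarrow> real) \<Rightarrow> nat \<Rightarrow> (nat \<Rightarrow> real ^ 'd) \<Rightarrow> real" where
  "lift_potential g F N x = potential g F N (\<lambda>i\<in>{..<N}. wrap g (x i))"

text \<open>Frechet differentiability at \<open>x\<close>, with gradient \<open>D\<close>, of a function of the first \<open>N\<close> entries
  of \<open>x\<close>, on $(\mathbb R^d)^N$ with its Euclidean norm. (The type \<open>nat \<Rightarrow> real ^ 'd\<close> is not a
  normed space, so \<^const>\<open>has_derivative\<close> does not apply.)\<close>

definition has_gradient ::
    "nat \<Rightarrow> ((nat \<Rightarrow> real ^ 'd::finite) \<Rightarrow> real) \<Rightarrow> (nat \<Rightarrow> real ^ 'd) \<Rightarrow> (nat \<Rightarrow> real ^ 'd) \<Rightarrow> bool" where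
  "has_gradient N u D x \<longleftrightarrow> (\<forall>e>0. \<exists>r>0. \<forall>w. L2_set (\<lambda>i. norm (w i)) {..<N} < r \<longrightarrow>
     \<bar>u (\<lambda>i. x i + w i) - u x - (\<Sum>i<N. D i \<bullet> w i)\<bar> \<le> e * L2_set (\<lambda>i. norm (w i)) {..<N})"

definition gradient ::
    "nat \<Rightarrow> ((nat \<Rightarrow> real ^ 'd::finite) \<Rightarrow> real) \<Rightarrow> (nat \<Rightarrow> real ^ 'd) \<Rightarrow> (nat \<Rightarrow> real ^ 'd)" where
  "gradient N u x = (THE D. D \<in> extensional {..<N} \<and> has_gradient N u D x)"

definition gibbs ::
    "geometry \<Rightarrow> ((real ^ 'd::finite) measure \<Rightarrow> real) \<Rightarrow> nat \<Rightarrow> (nat \<Rightarrow> real ^ 'd) measure" where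
  "gibbs g F N = density (lebN g N)
     (\<lambda>x. ennreal (exp (- potential g F N x) / (\<integral>y. exp (- potential g F N y) \<partial>lebN g N)))"


definition verlet ::
    "geometry \<Rightarrow> ((real ^ 'd::finite) measure \<Rightarrow> real) \<Rightarrow> nat \<Rightarrow> real \<Rightarrow>
     (nat \<Rightarrow> real ^ 'd) \<times> (nat \<Rightarrow> real ^ 'd) \<Rightarrow> (nat \<Rightarrow> real ^ 'd) \<times> (nat \<Rightarrow> real ^ 'd)" where
  "verlet g F N h = (\<lambda>(x, v).
     let dU = gradient N (lift_potential g F N);
         x' = (\<lambda>i\<in>{..<N}. wrap g (x i + h *\<^sub>R v i - (h\<^sup>2 / 2) *\<^sub>R dU x i));
         v' = (\<lambda>i\<in>{..<N}. v i - (h / 2) *\<^sub>R (dU x i + dU x' i))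
     in (x', v'))"

definition std_gaussian :: "(real ^ 'd::finite) measure" where
  "std_gaussian = distr (Pi\<^sub>M UNIV (\<lambda>_. density lborel std_normal_density)) borel (\<lambda>z. \<chi> k. z k)"

text \<open>Operators act on laws from the right, \<open>(\<nu> P) f = \<nu> (P f)\<close>, so \<open>P f = D (f \<circ> \<Phi>)\<close> means that
  one step first refreshes the velocities and then applies the Verlet map.\<close>

definition damp_law ::
    "geometry \<Rightarrow> nat \<Rightarrow> real \<Rightarrow> ((nat \<Rightarrow> real ^ 'd::finite) \<times> (nat \<Rightarrow> real ^ 'd)) measure \<Rightarrow>
     ((nat \<Rightarrow> real ^ 'd) \<times> (nat \<Rightarrow> real ^ 'd)) measure" where
  "damp_law g N \<eta> \<nu> = distr (\<nu> \<Otimes>\<^sub>M Pi\<^sub>M {..<N} (\<lambda>_. std_gaussian)) (phaseN g N)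
     (\<lambda>((x, v), G). (x, \<lambda>i\<in>{..<N}. \<eta> *\<^sub>R v i + sqrt (1 - \<eta>\<^sup>2) *\<^sub>R G i))"

definition step_law ::
    "geometry \<Rightarrow> ((real ^ 'd::finite) measure \<Rightarrow> real) \<Rightarrow> real \<Rightarrow> real \<Rightarrow> nat \<Rightarrow>
     ((nat \<Rightarrow> real ^ 'd) \<times> (nat \<Rightarrow> real ^ 'd)) measure \<Rightarrow>
     ((nat \<Rightarrow> real ^ 'd) \<times> (nat \<Rightarrow> real ^ 'd)) measure" where
  "step_law g F \<gamma> h N \<nu> = distr (damp_law g N (1 - \<gamma> * h) \<nu>) (phaseN g N) (verlet g F N h)"

definition position_law ::
    "geometry \<Rightarrow> ((real ^ 'd::finite) measure \<Rightarrow> real) \<Rightarrow> real \<Rightarrow> real \<Rightarrow> nat \<Rightarrow>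
     ((nat \<Rightarrow> real ^ 'd) \<times> (nat \<Rightarrow> real ^ 'd)) measure \<Rightarrow> nat \<Rightarrow> (nat \<Rightarrow> real ^ 'd) measure" where
  "position_law g F \<gamma> h N \<nu>\<^sub>0 n = distr ((step_law g F \<gamma> h N ^^ n) \<nu>\<^sub>0) (lebN g N) fst"

definition exchangeable ::
    "geometry \<Rightarrow> nat \<Rightarrow> ((nat \<Rightarrow> real ^ 'd::finite) \<times> (nat \<Rightarrow> real ^ 'd)) measure \<Rightarrow> bool" where
  "exchangeable g N \<nu> \<longleftrightarrow> (\<forall>\<sigma>. \<sigma> permutes {..<N} \<longrightarrow>
     distr \<nu> (phaseN g N) (\<lambda>(x, v). (\<lambda>i\<in>{..<N}. x (\<sigma> i), \<lambda>i\<in>{..<N}. v (\<sigma> i))) = \<nu>)"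

definition quadratic_risk ::
    "nat \<Rightarrow> (real ^ 'd::finite \<Rightarrow> real) \<Rightarrow> (nat \<Rightarrow> real ^ 'd) measure \<Rightarrow> (real ^ 'd) measure \<Rightarrow> real" where
  "quadratic_risk N f \<mu> mu_star = (\<integral>x. ((\<Sum>i<N. f (x i)) / real N - (\<integral>y. f y \<partial>mu_star))\<^sup>2 \<partial>\<mu>)"

definition pair_marginal ::
    "geometry \<Rightarrow> (nat \<Rightarrow> real ^ 'd::finite) measure \<Rightarrow> ((real ^ 'd) \<times> (real ^ 'd)) measure" where
  "pair_marginal g \<mu> = distr \<mu> (leb g \<Otimes>\<^sub>M leb g) (\<lambda>y. (y 0, y 1))"

end

(*
  Let u = f - mu_star(f) and a = 4 |f|^2, so that |u| <= 2 |f| and the risk is the mean of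
  (sum_i u(x_i))^2 / N^2. Under the Gibbs measure the diagonal contributes at most a/N and, by
  permutation symmetry, each off-diagonal pair at most a TV; passing from the law of the chain to
  the Gibbs measure costs a sqrt(2 H) by Pinsker's inequality, which gives (i).

  For (ii), a round-robin tournament splits the unordered pairs {i, j} into N families indexed by
  s = i + j mod N. Under the product measure each family is a sum of at most N/2 independent centered
  variables u(x_i) u(x_j), bounded by a, hence subgaussian by Hoeffding's lemma. The variational
  formula for the entropy then bounds its mean under the law of the chain by a sqrt(N H).
*)
theory Submission
  imports Defs "HOL-Probability.Hoeffding"
begin

section \<open>Entropy duality, subgaussian functions and Pinsker's inequality\<close>

text \<open>The Donsker-Varadhan bound. Subtracting \<open>K\<close> and the log density from
  \<open>\<phi>\<close> leaves \<open>G\<close>, whose exponential has mean at most 1 under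
  \<open>N\<close>; the inequality 1 + t <= exp t then forces the mean of \<open>G\<close> to be at
  most 0.\<close>

lemma (in prob_space) entropy_duality:
  fixes \<phi> :: "'a \<Rightarrow> real"
  assumes N: "prob_space N" and sets_eq: "sets N = sets M"
    and ac: "absolutely_continuous M N"
    and int: "integrable N (entropy_density (exp 1) M N)"
    and \<phi>: "integrable N \<phi>"
    and exp_le: "(\<integral>\<^sup>+x. ennreal (exp (\<phi> x)) \<partial>M) \<le> ennreal (exp K)"
  shows "(\<integral>x. \<phi> x \<partial>N) \<le> KL_divergence (exp 1) M N + K"
proof -
  interpret N: prob_space N by fact
  define \<rho> where "\<rho> = RN_deriv M N"
  define G where "G x = \<phi> x - K - ln (enn2real (\<rho> x))" for x
  have \<rho>: "\<rho> \<in> borel_measurable M" by (simp add: \<rho>_def)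
  have ent: "entropy_density (exp 1) M N = (\<lambda>x. ln (enn2real (\<rho> x)))"
    by (simp add: entropy_density_def \<rho>_def fun_eq_iff log_def)
  have \<phi>': "\<phi> \<in> borel_measurable M"
    using \<phi> sets_eq by (metis borel_measurable_integrable measurable_cong_sets)
  have dens: "density M \<rho> = N"
    unfolding \<rho>_def by (rule density_RN_deriv[OF ac sets_eq])
  have fin: "AE x in M. \<rho> x \<noteq> \<infinity>"
    unfolding \<rho>_def by (rule RN_deriv_finite[OF N.sigma_finite_measure_axioms ac sets_eq])
  have intG: "integrable N G"
    unfolding G_def using \<phi> int ent by simp
  have "(\<integral>\<^sup>+x. ennreal (exp (G x)) \<partial>N) = (\<integral>\<^sup>+x. \<rho> x * ennreal (exp (G x)) \<partial>M)"
    unfolding dens[symmetric] G_def by (rule nn_integral_density) (use \<rho> \<phi>' in measurable)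
  \<comment> \<open>Only an inequality: where the density vanishes the left integrand is 0 and the
    right one is positive.\<close>
  also have "\<dots> \<le> (\<integral>\<^sup>+x. ennreal (exp (- K)) * ennreal (exp (\<phi> x)) \<partial>M)"
  proof (rule nn_integral_mono_AE, use fin in eventually_elim)
    case (elim x)
    define r where "r = enn2real (\<rho> x)"
    have r: "\<rho> x = ennreal r" "r \<ge> 0" using elim by (simp_all add: r_def less_top)
    have "r * exp (G x) \<le> exp (- K) * exp (\<phi> x)"
      using r(2) by (cases "r = 0") (simp_all add: G_def r_def[symmetric] exp_diff exp_minus exp_add field_simps)
    then show ?case
      using r by (simp flip: ennreal_mult add: ennreal_leI)
  qed
  also have "\<dots> = ennreal (exp (- K)) * (\<integral>\<^sup>+x. ennreal (exp (\<phi> x)) \<partial>M)"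
    using \<phi>' by (intro nn_integral_cmult) measurable
  also have "\<dots> \<le> ennreal (exp (- K)) * ennreal (exp K)"
    by (intro mult_left_mono exp_le) simp
  also have "\<dots> = 1" by (simp flip: ennreal_mult exp_add)
  finally have nn: "(\<integral>\<^sup>+x. ennreal (exp (G x)) \<partial>N) \<le> 1" .
  have expG: "integrable N (\<lambda>x. exp (G x))"
    using nn intG by (intro integrableI_bounded) (auto simp: top_unique less_top[symmetric])
  have "ennreal (\<integral>x. exp (G x) \<partial>N) \<le> 1"
    using nn by (subst nn_integral_eq_integral[OF expG, symmetric]) auto
  then have "(\<integral>x. exp (G x) \<partial>N) \<le> 1" by simp
  moreover have "(\<integral>x. 1 + G x \<partial>N) \<le> (\<integral>x. exp (G x) \<partial>N)"
    using intG expG by (intro integral_mono) auto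
  moreover have "(\<integral>x. 1 + G x \<partial>N) = 1 + ((\<integral>x. \<phi> x \<partial>N) - K - KL_divergence (exp 1) M N)"
    using \<phi> int by (simp add: G_def KL_divergence_def ent N.prob_space)
  ultimately show ?thesis by simp
qed

text \<open>Duality for \<open>l * \<phi>\<close> gives \<open>l * E <= H + l^2 * c / 2\<close> with
  \<open>E\<close> the mean of \<open>\<phi>\<close>, and it remains to choose \<open>l\<close>. The
  number \<open>c\<close> is a variance proxy.\<close>

lemma (in prob_space) mean_le_sqrt_entropy:
  fixes \<phi> :: "'a \<Rightarrow> real"
  assumes N: "prob_space N" and sets_eq: "sets N = sets M"
    and ent: "rel_entropy N M = ereal H"
    and \<phi>: "integrable N \<phi>" and c: "0 \<le> c"
    and subgaussian:
      "\<And>l. 0 < l \<Longrightarrow> (\<integral>\<^sup>+x. ennreal (exp (l * \<phi> x)) \<partial>M) \<le> ennreal (exp (l\<^sup>2 * c / 2))"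
  shows "0 \<le> H" and "(\<integral>x. \<phi> x \<partial>N) \<le> sqrt (2 * c * H)"
proof -
  have ac: "absolutely_continuous M N" and int: "integrable N (entropy_density (exp 1) M N)"
    and H: "H = KL_divergence (exp 1) M N"
    using ent by (auto simp: rel_entropy_def split: if_splits)
  note dual = entropy_duality[OF N sets_eq ac int, folded H]
  show "0 \<le> H"
    using dual[of "\<lambda>_. 0" 0] by (simp add: emeasure_space_1)
  define E where "E = (\<integral>x. \<phi> x \<partial>N)"
  have *: "l * E \<le> H + l\<^sup>2 * c / 2" if "0 < l" for l
    using dual[of "\<lambda>x. l * \<phi> x" "l\<^sup>2 * c / 2"] subgaussian[OF that] \<phi> by (simp add: E_def)
  show "(\<integral>x. \<phi> x \<partial>N) \<le> sqrt (2 * c * H)"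
  proof (cases "E \<le> 0")
    case True
    then show ?thesis using c \<open>0 \<le> H\<close> unfolding E_def[symmetric]
      by (meson mult_nonneg_nonneg order_trans real_sqrt_ge_zero zero_le_numeral)
  next
    case False
    \<comment> \<open>If \<open>c\<close> were 0, then \<open>l * E <= H\<close> for every
      \<open>l > 0\<close>, which fails at \<open>l = (H + 1) / E\<close>.\<close>
    have "c \<noteq> 0"
      using *[of "(H + 1) / E"] False \<open>0 \<le> H\<close> by auto
    then have "c > 0" using c by simp
    \<comment> \<open>The choice \<open>l = E / c\<close> maximizes
      \<open>l * E - l^2 * c / 2\<close>.\<close>
    then have "E\<^sup>2 \<le> 2 * c * H"
      using *[of "E / c"] False by (simp add: field_simps power2_eq_square)
    then show ?thesis unfolding E_def[symmetric] by (rule real_le_rsqrt)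
  qed
qed

text \<open>The interval from \<open>- a\<close> to \<open>a\<close> has length
  \<open>2 * a\<close>, so Hoeffding's exponent \<open>l^2 * (2 * a)^2 / 8\<close> becomes
  \<open>l^2 * a^2 / 2\<close>: the variance proxy is \<open>a^2\<close>.\<close>

lemma (in prob_space) hoeffding_symmetric:
  fixes \<phi> :: "'a \<Rightarrow> real"
  assumes \<phi>: "\<phi> \<in> borel_measurable M" and bound: "AE x in M. \<bar>\<phi> x\<bar> \<le> a" and "0 < l"
  shows "(\<integral>\<^sup>+x. ennreal (exp (l * (\<phi> x - expectation \<phi>))) \<partial>M) \<le> ennreal (exp (l\<^sup>2 * a\<^sup>2 / 2))"
proof -
  interpret interval_bounded_random_variable M \<phi> "- a" a
    by unfold_locales (use \<phi> bound in \<open>auto elim: eventually_mono\<close>)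
  show ?thesis
    using Hoeffdings_lemma_nn_integral[OF \<open>0 < l\<close>] by (simp add: power2_eq_square field_simps)
qed

text \<open>The centered function is subgaussian with variance proxy \<open>a^2\<close>, so this is
  an instance of \<open>mean_le_sqrt_entropy\<close>. The one-sided form is what an upper bound on
  the risk calls for.\<close>

lemma (in prob_space) pinsker:
  fixes \<phi> :: "'a \<Rightarrow> real"
  assumes N: "prob_space N" and sets_eq: "sets N = sets M"
    and ent: "rel_entropy N M = ereal H"
    and \<phi>: "\<phi> \<in> borel_measurable M" and bound: "\<And>x. x \<in> space M \<Longrightarrow> \<bar>\<phi> x\<bar> \<le> a" and a: "0 \<le> a"
  shows "(\<integral>x. \<phi> x \<partial>N) \<le> (\<integral>x. \<phi> x \<partial>M) + a * sqrt (2 * H)"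
proof -
  interpret N: prob_space N by fact
  have "integrable N \<phi>"
    using bound sets_eq_imp_space_eq[OF sets_eq] \<phi>
    by (intro N.integrable_const_bound[of _ a]) (auto simp: measurable_cong_sets[OF sets_eq refl])
  moreover have "(\<integral>x. \<phi> x - (\<integral>x. \<phi> x \<partial>M) \<partial>N) \<le> sqrt (2 * a\<^sup>2 * H)"
    using calculation \<phi> bound
    by (intro mean_le_sqrt_entropy(2)[OF N sets_eq ent] hoeffding_symmetric) auto
  ultimately show ?thesis
    using a by (simp add: N.prob_space real_sqrt_mult mult_ac)
qed

section \<open>Round-robin decomposition of the pairs of indices\<close>

text \<open>\<open>(s - i) mod N\<close> for \<open>i \<le> N\<close>, avoiding the truncated subtraction \<open>s - i\<close>.\<close>

definition opponent :: "nat \<Rightarrow> nat \<Rightarrow> nat \<Rightarrow> nat" where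
  "opponent N s i = (s + (N - i)) mod N"

text \<open>Both remainders are of numbers below \<open>2 * N\<close>, hence at most one subtraction
  of \<open>N\<close>. The condition on the right is symmetric in \<open>i\<close> and
  \<open>j\<close>, which makes each round an involution.\<close>

lemma opponent_iff:
  assumes "i < N" "j < N" "s < N"
  shows "opponent N s i = j \<longleftrightarrow> (i + j) mod N = s"
proof -
  have 1: "(s + (N - i)) mod N = (if s < i then s + N - i else s - i)"
    using assms by (auto simp: mod_if)
  have 2: "(i + j) mod N = (if i + j < N then i + j else i + j - N)"
    using assms by (auto simp: mod_if)
  show ?thesis unfolding opponent_def 1 2 using assms by (auto split: if_splits)
qed

lemma opponent_less: "0 < N \<Longrightarrow> opponent N s i < N"
  by (simp add: opponent_def)

lemma opponent_involutive: "i < N \<Longrightarrow> s < N \<Longrightarrow> opponent N s (opponent N s i) = i"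
  by (metis add.commute opponent_iff opponent_less gr_zeroI not_less_zero)

text \<open>For fixed \<open>i\<close>, the opponent \<open>j\<close> and the round
  \<open>s = (i + j) mod N\<close> determine each other, so every ordered pair occurs in exactly one
  of the \<open>N\<close> rounds.\<close>

lemma sum_pairs_round_robin:
  fixes c :: "nat \<Rightarrow> nat \<Rightarrow> 'a::comm_monoid_add"
  shows "(\<Sum>i<N. \<Sum>j<N. c i j) = (\<Sum>s<N. \<Sum>i<N. c i (opponent N s i))"
proof -
  have "(\<Sum>j<N. c i j) = (\<Sum>s<N. c i (opponent N s i))" if "i < N" for i
  proof (rule sum.reindex_bij_witness[of _ "\<lambda>s. opponent N s i" "\<lambda>j. (i + j) mod N"])
    have "0 < N" using that by simp
    fix j assume "j \<in> {..<N}"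
    then show "opponent N ((i + j) mod N) i = j"
      using that \<open>0 < N\<close> by (simp add: opponent_iff)
    then show "c i (opponent N ((i + j) mod N) i) = c i j" by simp
  next
    fix s assume "s \<in> {..<N}"
    then show "(i + opponent N s i) mod N = s"
      using that opponent_iff[of i N "opponent N s i" s] opponent_less[of N s i] by simp
  qed (use that in \<open>auto simp: opponent_less\<close>)
  then show ?thesis
    by (subst sum.swap) simp
qed

text \<open>Fixed points contribute nothing, and \<open>\<tau>\<close> exchanges the indices below
  their partner with those above it, so each pair is counted twice. Keeping one representative per
  pair leaves terms in disjoint sets of coordinates, hence independent ones under a product
  measure.\<close>

lemma sum_involution:
  fixes c :: "nat \<Rightarrow> nat \<Rightarrow> 'a::comm_semiring_1"
  assumes less: "\<And>i. i < N \<Longrightarrow> \<tau> i < N" and inv: "\<And>i. i < N \<Longrightarrow> \<tau> (\<tau> i) = i"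
    and sym: "\<And>i j. c i j = c j i" and diag: "\<And>i. c i i = 0"
  shows "(\<Sum>i<N. c i (\<tau> i)) = 2 * (\<Sum>i | i < N \<and> i < \<tau> i. c i (\<tau> i))"
    and "2 * card {i. i < N \<and> i < \<tau> i} \<le> N"
proof -
  let ?D = "{i. i < N \<and> \<tau> i = i}" and ?P = "{i. i < N \<and> i < \<tau> i}" and ?Q = "{i. i < N \<and> \<tau> i < i}"
  have un: "{..<N} = ?D \<union> (?P \<union> ?Q)" by auto
  have bij: "bij_betw \<tau> ?P ?Q"
    by (rule bij_betw_byWitness[where f' = \<tau>]) (use less inv in auto)
  have Q: "(\<Sum>i\<in>?Q. c i (\<tau> i)) = (\<Sum>i\<in>?P. c i (\<tau> i))"
    using sum.reindex_bij_betw[OF bij, of "\<lambda>i. c i (\<tau> i)"] inv sym by (auto intro!: sum.cong)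
  have "(\<Sum>i<N. c i (\<tau> i)) = (\<Sum>i\<in>?D. c i (\<tau> i)) + ((\<Sum>i\<in>?P. c i (\<tau> i)) + (\<Sum>i\<in>?Q. c i (\<tau> i)))"
    unfolding un by (subst sum.union_disjoint; (subst sum.union_disjoint)?) auto
  moreover have "(\<Sum>i\<in>?D. c i (\<tau> i)) = 0"
    by (rule sum.neutral) (simp add: diag)
  ultimately show "(\<Sum>i<N. c i (\<tau> i)) = 2 * (\<Sum>i\<in>?P. c i (\<tau> i))"
    unfolding Q by (simp add: mult_2)
  have "card ?P = card ?Q" using bij by (rule bij_betw_same_card)
  moreover have "card (?P \<union> ?Q) \<le> card {..<N}" by (rule card_mono) auto
  moreover have "card (?P \<union> ?Q) = card ?P + card ?Q" by (rule card_Un_disjoint) auto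
  ultimately show "2 * card ?P \<le> N" by simp
qed

text \<open>The cross terms form a function vanishing at \<open>i = j\<close>, so that an index
  paired with itself drops out of its round, as \<open>sum_involution\<close> requires.\<close>

lemma square_sum_off_diagonal:
  fixes v :: "nat \<Rightarrow> 'a::comm_semiring_1"
  shows "(\<Sum>i<N. v i)\<^sup>2 = (\<Sum>i<N. (v i)\<^sup>2) + (\<Sum>i<N. \<Sum>j<N. if i = j then 0 else v i * v j)"
proof -
  have "(\<Sum>i<N. v i)\<^sup>2 = (\<Sum>i<N. \<Sum>j<N. (if i = j then (v i)\<^sup>2 else 0) + (if i = j then 0 else v i * v j))"
    by (auto simp: power2_eq_square sum_product intro!: sum.cong)
  then show ?thesis by (simp add: sum.distrib)
qed

section \<open>Sums of independent products and the second moment\<close>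

text \<open>Independence factorizes the exponential moment, so the variance proxies add up to
  \<open>card P * a^2\<close>, instead of the \<open>(card P * a)^2\<close> that the sup bound of
  the sum would give.\<close>

lemma (in prob_space) hoeffding_indep_sum:
  fixes Z :: "'i \<Rightarrow> 'a \<Rightarrow> real"
  assumes fin: "finite P" and indep: "indep_vars (\<lambda>_. borel) Z P"
    and bound: "\<And>i. i \<in> P \<Longrightarrow> AE x in M. \<bar>Z i x\<bar> \<le> a"
    and mean: "\<And>i. i \<in> P \<Longrightarrow> expectation (Z i) = 0" and "0 < l"
  shows "(\<integral>\<^sup>+x. ennreal (exp (l * (\<Sum>i\<in>P. Z i x))) \<partial>M) \<le> ennreal (exp (l\<^sup>2 * (real (card P) * a\<^sup>2) / 2))"
proof -
  have "(\<integral>\<^sup>+x. ennreal (exp (l * (\<Sum>i\<in>P. Z i x))) \<partial>M) = (\<integral>\<^sup>+x. (\<Prod>i\<in>P. ennreal (exp (l * Z i x))) \<partial>M)"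
    by (simp add: sum_distrib_left exp_sum fin prod_ennreal)
  also have "\<dots> = (\<Prod>i\<in>P. \<integral>\<^sup>+x. ennreal (exp (l * Z i x)) \<partial>M)"
    by (intro indep_vars_nn_integral fin indep_vars_compose2[OF indep]) auto
  also have "\<dots> \<le> (\<Prod>i\<in>P. ennreal (exp (l\<^sup>2 * a\<^sup>2 / 2)))"
  proof (intro prod_mono_ennreal)
    fix i assume i: "i \<in> P"
    have "Z i \<in> borel_measurable M" using indep i by (auto simp: indep_vars_def)
    from hoeffding_symmetric[OF this bound[OF i] \<open>0 < l\<close>] mean[OF i]
    show "(\<integral>\<^sup>+x. ennreal (exp (l * Z i x)) \<partial>M) \<le> ennreal (exp (l\<^sup>2 * a\<^sup>2 / 2))" by simp
  qed
  also have "\<dots> = ennreal (exp (l\<^sup>2 * (real (card P) * a\<^sup>2) / 2))"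
    by (simp add: ennreal_power exp_of_nat_mult[symmetric] mult_ac)
  finally show ?thesis .
qed

text \<open>Independence says that the joint law is the product of the marginals. Restriction to
  \<open>I\<close> is the identity on the product space, so the joint law is \<open>PiM I M\<close>
  itself. The criterion is stated for nonempty \<open>I\<close>, hence the case split.\<close>

lemma indep_vars_PiM_coordinates:
  assumes "\<And>i. i \<in> I \<Longrightarrow> prob_space (M i)"
  shows "prob_space.indep_vars (PiM I M) M (\<lambda>i x. x i) I"
proof -
  interpret prob_space "PiM I M" using assms by (rule prob_space_PiM)
  show ?thesis
  proof (cases "I = {}")
    case True
    then show ?thesis unfolding indep_vars_def indep_sets_def by simp
  next
    case False
    have "distr (PiM I M) (PiM I M) (\<lambda>x. \<lambda>i\<in>I. x i) = distr (PiM I M) (PiM I M) (\<lambda>x. x)"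
      by (rule distr_cong) (auto simp: space_PiM)
    also have "\<dots> = (PiM I M)" by simp
    also have "\<dots> = (\<Pi>\<^sub>M i\<in>I. distr (PiM I M) (M i) (\<lambda>x. x i))"
      by (rule PiM_cong) (simp_all add: distr_PiM_component assms)
    finally show ?thesis
      by (subst indep_vars_iff_distr_eq_PiM'[OF False]) auto
  qed
qed

lemma (in prob_space) PiM_centered_pair:
  fixes u :: "'a \<Rightarrow> real"
  assumes fin: "finite I" and ij: "i \<in> I" "j \<in> I" "i \<noteq> j" and u: "integrable M u" "expectation u = 0"
  shows "(\<integral>x. u (x i) * u (x j) \<partial>PiM I (\<lambda>_. M)) = 0"
proof -
  interpret product_sigma_finite "\<lambda>_. M" ..
  \<comment> \<open>Padding with the constant 1 outside \<open>{i, j}\<close> gives a product over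
    all of \<open>I\<close>, whose integral factorizes; the factor at \<open>i\<close> is 0.\<close>
  define w where "w k = (if k \<in> {i, j} then u else (\<lambda>_. 1))" for k
  have "(\<integral>x. u (x i) * u (x j) \<partial>PiM I (\<lambda>_. M)) = (\<integral>x. (\<Prod>k\<in>I. w k (x k)) \<partial>PiM I (\<lambda>_. M))"
  proof (rule arg_cong[where f = "integral\<^sup>L _"], rule ext)
    fix x
    have "(\<Prod>k\<in>I. w k (x k)) = (\<Prod>k\<in>{i, j}. w k (x k))"
      using fin ij by (intro prod.mono_neutral_right) (auto simp: w_def)
    then show "u (x i) * u (x j) = (\<Prod>k\<in>I. w k (x k))"
      using ij by (simp add: w_def)
  qed
  also have "\<dots> = (\<Prod>k\<in>I. integral\<^sup>L M (w k))"
    using u by (intro product_integral_prod fin) (simp add: w_def)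
  also have "\<dots> = 0"
    using fin ij u by (intro prod_zero) (auto simp: w_def)
  finally show ?thesis .
qed

text \<open>The terms use disjoint pairs of coordinates and are thus independent. Each is centered
  because \<open>i\<close> and \<open>\<tau> i\<close> differ, and bounded by \<open>b^2\<close>,
  whence the fourth power of \<open>b\<close>.\<close>

lemma (in prob_space) subgaussian_matching:
  fixes u :: "'a \<Rightarrow> real" and \<tau> :: "nat \<Rightarrow> nat"
  assumes u: "u \<in> borel_measurable M" and bound: "\<And>x. x \<in> space M \<Longrightarrow> \<bar>u x\<bar> \<le> b"
    and mean: "expectation u = 0"
    and less: "\<And>i. i < N \<Longrightarrow> \<tau> i < N" and inv: "\<And>i. i < N \<Longrightarrow> \<tau> (\<tau> i) = i" and "0 < l"
  defines "P \<equiv> {i. i < N \<and> i < \<tau> i}"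
  shows "(\<integral>\<^sup>+x. ennreal (exp (l * (\<Sum>i\<in>P. u (x i) * u (x (\<tau> i))))) \<partial>PiM {..<N} (\<lambda>_. M))
    \<le> ennreal (exp (l\<^sup>2 * (real (card P) * (b\<^sup>2)\<^sup>2) / 2))"
proof -
  interpret X: prob_space "PiM {..<N} (\<lambda>_. M)" by (intro prob_space_PiM prob_space_axioms)
  have P: "i < N" "\<tau> i < N" "i \<noteq> \<tau> i" if "i \<in> P" for i
    using that less by (auto simp: P_def)
  have "X.indep_vars (\<lambda>i. PiM {i, \<tau> i} (\<lambda>_. M)) (\<lambda>i x. restrict (\<lambda>k. x k) {i, \<tau> i}) P"
  proof (rule X.indep_vars_restrict)
    show "X.indep_vars (\<lambda>_. M) (\<lambda>i x. x i) {..<N}"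
      by (intro indep_vars_PiM_coordinates prob_space_axioms)
    \<comment> \<open>Blocks sharing an index are the same pair, and only its smaller index belongs
      to \<open>P\<close>.\<close>
    show "disjoint_family_on (\<lambda>i. {i, \<tau> i}) P"
      unfolding disjoint_family_on_def P_def using inv by auto (metis less_asym)+
  qed (use P in auto)
  then have "X.indep_vars (\<lambda>_. borel)
      (\<lambda>i x. (\<lambda>y. u (y i) * u (y (\<tau> i))) (restrict (\<lambda>k. x k) {i, \<tau> i})) P"
    by (rule X.indep_vars_compose2) (use u in measurable)
  then have indep: "X.indep_vars (\<lambda>_. borel) (\<lambda>i x. u (x i) * u (x (\<tau> i))) P"
    by simp
  have int: "integrable M u"
    using bound u by (intro integrable_const_bound[of _ b]) auto
  show ?thesis
  proof (rule X.hoeffding_indep_sum[OF _ indep])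
    show "AE x in PiM {..<N} (\<lambda>_. M). \<bar>u (x i) * u (x (\<tau> i))\<bar> \<le> b\<^sup>2" if "i \<in> P" for i
    proof (rule AE_I2)
      fix x assume "x \<in> space (PiM {..<N} (\<lambda>_. M))"
      then have "x i \<in> space M" "x (\<tau> i) \<in> space M" using P[OF that] by (auto simp: space_PiM)
      then show "\<bar>u (x i) * u (x (\<tau> i))\<bar> \<le> b\<^sup>2"
        unfolding abs_mult power2_eq_square by (intro mult_mono' bound) auto
    qed
    show "X.expectation (\<lambda>x. u (x i) * u (x (\<tau> i))) = 0" if "i \<in> P" for i
      using P[OF that] by (intro PiM_centered_pair int mean) auto
  qed (auto simp: P_def \<open>0 < l\<close>)
qed

text \<open>The diagonal gives at most \<open>N * b^2\<close>. The entropy bound is applied to each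
  of the \<open>N\<close> rounds separately, because independence is available only within a
  round.\<close>

lemma (in prob_space) chaos_second_moment:
  fixes u :: "'a \<Rightarrow> real" and \<mu> :: "(nat \<Rightarrow> 'a) measure"
  assumes u: "u \<in> borel_measurable M" and bound: "\<And>x. x \<in> space M \<Longrightarrow> \<bar>u x\<bar> \<le> b"
    and mean: "expectation u = 0"
    and \<mu>: "prob_space \<mu>" and sets_eq: "sets \<mu> = sets (PiM {..<N} (\<lambda>_. M))"
    and ent: "rel_entropy \<mu> (PiM {..<N} (\<lambda>_. M)) = ereal H"
  shows "(\<integral>x. (\<Sum>i<N. u (x i))\<^sup>2 \<partial>\<mu>) \<le> real N * b\<^sup>2 + 2 * real N * b\<^sup>2 * sqrt (real N * H)"
proof -
  interpret X: prob_space "PiM {..<N} (\<lambda>_. M)" by (intro prob_space_PiM prob_space_axioms)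
  interpret \<mu>: prob_space \<mu> by fact
  have uu: "\<bar>u (x i) * u (x j)\<bar> \<le> b\<^sup>2" if "i < N" "j < N" "x \<in> space \<mu>" for i j x
  proof -
    have "x i \<in> space M" "x j \<in> space M"
      using that sets_eq_imp_space_eq[OF sets_eq] by (auto simp: space_PiM)
    then show ?thesis
      unfolding abs_mult power2_eq_square by (intro mult_mono' bound) auto
  qed
  have [measurable]: "(\<lambda>x. u (x i) * u (x j)) \<in> borel_measurable \<mu>" if "i < N" "j < N" for i j
    unfolding measurable_cong_sets[OF sets_eq refl]
    by (intro borel_measurable_times measurable_compose[OF _ u] measurable_component_singleton)
      (use that in auto)
  have int: "integrable \<mu> (\<lambda>x. u (x i) * u (x j))" if "i < N" "j < N" for i j
    using that uu by (intro \<mu>.integrable_const_bound[of _ "b\<^sup>2"]) auto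
  have "0 \<le> H"
    using X.mean_le_sqrt_entropy(1)[OF \<mu> sets_eq ent, of "\<lambda>_. 0" 0] by (simp add: X.emeasure_space_1)
  let ?c = "\<lambda>x i j. if i = j then 0 else u (x i) * u (x j)"
  have intc: "integrable \<mu> (\<lambda>x. ?c x i j)" if "i < N" "j < N" for i j
    using int[OF that] by (cases "i = j") auto
  have matching: "(\<integral>x. (\<Sum>i<N. ?c x i (\<tau> i)) \<partial>\<mu>) \<le> 2 * b\<^sup>2 * sqrt (real N * H)"
    if less: "\<And>i. i < N \<Longrightarrow> \<tau> i < N" and inv: "\<And>i. i < N \<Longrightarrow> \<tau> (\<tau> i) = i" for \<tau>
  proof -
    define P where "P = {i. i < N \<and> i < \<tau> i}"
    have c: "(\<Sum>i<N. ?c x i (\<tau> i)) = 2 * (\<Sum>i\<in>P. u (x i) * u (x (\<tau> i)))" for x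
      using sum_involution(1)[of N \<tau> "?c x", OF less inv]
      by (auto simp: P_def mult.commute intro!: sum.cong)
    have "(\<integral>x. (\<Sum>i\<in>P. u (x i) * u (x (\<tau> i))) \<partial>\<mu>) \<le> sqrt (2 * (real (card P) * (b\<^sup>2)\<^sup>2) * H)"
    proof (rule X.mean_le_sqrt_entropy(2)[OF \<mu> sets_eq ent])
      show "integrable \<mu> (\<lambda>x. \<Sum>i\<in>P. u (x i) * u (x (\<tau> i)))"
        by (intro Bochner_Integration.integrable_sum int) (auto simp: P_def less)
    qed (use subgaussian_matching[OF u bound mean less inv] in \<open>simp_all add: P_def\<close>)
    \<comment> \<open>The bound \<open>card P <= N / 2\<close> absorbs the 2 under the root; the
      factor 2 in \<open>matching\<close> comes from counting each pair twice.\<close>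
    also have "\<dots> \<le> sqrt ((b\<^sup>2)\<^sup>2 * (real N * H))"
    proof (rule real_sqrt_le_mono)
      have "real (2 * card P) \<le> real N"
        unfolding P_def of_nat_le_iff
        by (rule sum_involution(2)[where c = "\<lambda>_ _. 0::nat", OF less inv]) auto
      then have "real (2 * card P) * ((b\<^sup>2)\<^sup>2 * H) \<le> real N * ((b\<^sup>2)\<^sup>2 * H)"
        using \<open>0 \<le> H\<close> by (intro mult_right_mono) auto
      then show "2 * (real (card P) * (b\<^sup>2)\<^sup>2) * H \<le> (b\<^sup>2)\<^sup>2 * (real N * H)"
        by (simp add: mult_ac)
    qed
    also have "\<dots> = b\<^sup>2 * sqrt (real N * H)"
      by (simp only: real_sqrt_mult real_sqrt_abs abs_power2)
    finally show ?thesis unfolding c by simp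
  qed
  have "(\<integral>x. (\<Sum>i<N. u (x i))\<^sup>2 \<partial>\<mu>) =
      (\<integral>x. (\<Sum>i<N. (u (x i))\<^sup>2) + (\<Sum>s<N. \<Sum>i<N. ?c x i (opponent N s i)) \<partial>\<mu>)"
    by (intro arg_cong[where f = "integral\<^sup>L \<mu>"] ext)
      (subst square_sum_off_diagonal, rule arg_cong[OF sum_pairs_round_robin])
  also have "\<dots> = (\<Sum>i<N. (\<integral>x. (u (x i))\<^sup>2 \<partial>\<mu>)) + (\<Sum>s<N. (\<integral>x. (\<Sum>i<N. ?c x i (opponent N s i)) \<partial>\<mu>))"
  proof -
    have "integrable \<mu> (\<lambda>x. (u (x i))\<^sup>2)" if "i \<in> {..<N}" for i
      using that int[of i i] by (simp add: power2_eq_square)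
    moreover have "integrable \<mu> (\<lambda>x. \<Sum>i<N. ?c x i (opponent N s i))" if "s \<in> {..<N}" for s
      by (intro Bochner_Integration.integrable_sum intc) (use that in \<open>auto intro: opponent_less\<close>)
    ultimately show ?thesis
      by (subst Bochner_Integration.integral_add)
        (simp_all only: Bochner_Integration.integral_sum Bochner_Integration.integrable_sum)
  qed
  also have "\<dots> \<le> (\<Sum>i<N. b\<^sup>2) + (\<Sum>s<N. 2 * b\<^sup>2 * sqrt (real N * H))"
  proof (intro add_mono sum_mono)
    show "(\<integral>x. (u (x i))\<^sup>2 \<partial>\<mu>) \<le> b\<^sup>2" if "i \<in> {..<N}" for i
      using that int[of i i] uu[of i i] unfolding power2_eq_square[of "u _"]
      by (intro \<mu>.integral_le_const) auto
    show "(\<integral>x. (\<Sum>i<N. ?c x i (opponent N s i)) \<partial>\<mu>) \<le> 2 * b\<^sup>2 * sqrt (real N * H)"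
      if "s \<in> {..<N}" for s
      using that by (intro matching opponent_less opponent_involutive) auto
  qed
  finally show ?thesis by simp
qed

section \<open>State space and invariance under relabelling\<close>

lemma states_borel: "states g \<in> sets borel"
proof (cases g)
  case Torus
  have "{x :: real ^ 'd. \<forall>k. 0 \<le> x $ k \<and> x $ k < 1} \<in> sets borel" by measurable
  then show ?thesis by (simp add: Torus)
qed simp

lemma space_leb [simp]: "space (leb g) = states g"
  by (simp add: leb_def space_restrict_space)

lemma sigma_finite_leb: "sigma_finite_measure (leb g)"
  unfolding leb_def
  by (rule sigma_finite_measure_restrict_space[OF lborel.sigma_finite_measure_axioms])
    (simp add: states_borel)

text \<open>Used to show that the Gibbs normalizing constant is positive. The open unit box lies in
  both state spaces and has volume 1.\<close>

lemma emeasure_leb_states: "emeasure (leb g :: (real ^ 'd::finite) measure) (states g) \<noteq> 0"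
proof
  let ?B = "box 0 (\<chi> i. 1) :: (real ^ 'd) set"
  assume "emeasure (leb g :: (real ^ 'd) measure) (states g) = 0"
  then have "emeasure lborel (states g :: (real ^ 'd) set) = 0"
    unfolding leb_def by (subst (asm) emeasure_restrict_space) (simp_all add: states_borel)
  moreover have "?B \<subseteq> states g"
    by (cases g) (auto simp: mem_box_cart less_imp_le)
  ultimately have "emeasure lborel ?B = 0"
    using emeasure_mono[of ?B "states g" lborel] by (simp add: states_borel)
  moreover have "emeasure lborel ?B = 1"
    by (subst emeasure_lborel_box) (auto simp: Basis_vec_def inner_axis intro!: prod.neutral)
  ultimately show False by simp
qed

text \<open>Boxes determine the measure. The preimage of a box has the same sides rearranged by
  \<open>inv \<sigma>\<close>, so its measure is the same product in another order.\<close>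

lemma distr_PiM_permute:
  assumes M: "sigma_finite_measure M" and fin: "finite I" and \<sigma>: "\<sigma> permutes I"
  shows "distr (PiM I (\<lambda>_. M)) (PiM I (\<lambda>_. M)) (\<lambda>x. \<lambda>i\<in>I. x (\<sigma> i)) = PiM I (\<lambda>_. M)"
proof -
  interpret product_sigma_finite "\<lambda>_. M" using M by (simp add: product_sigma_finite_def)
  have in_I: "\<sigma> i \<in> I \<longleftrightarrow> i \<in> I" for i by (rule permutes_in_image[OF \<sigma>])
  have meas: "(\<lambda>x. \<lambda>i\<in>I. x (\<sigma> i)) \<in> PiM I (\<lambda>_. M) \<rightarrow>\<^sub>M PiM I (\<lambda>_. M)"
    by (intro measurable_restrict measurable_component_singleton) (simp add: in_I)
  show ?thesis
  proof (rule PiM_eqI[OF fin])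
    fix A assume A: "\<And>i. i \<in> I \<Longrightarrow> A i \<in> sets M"
    let ?A' = "\<lambda>i. A (inv \<sigma> i)"
    have inv_in: "inv \<sigma> i \<in> I \<longleftrightarrow> i \<in> I" for i
      using permutes_in_image[OF permutes_inv[OF \<sigma>]] .
    have "(\<lambda>x. \<lambda>i\<in>I. x (\<sigma> i)) -` PiE I A \<inter> space (PiM I (\<lambda>_. M)) = PiE I ?A'"
    proof (intro set_eqI iffI)
      fix x assume x: "x \<in> (\<lambda>x. \<lambda>i\<in>I. x (\<sigma> i)) -` PiE I A \<inter> space (PiM I (\<lambda>_. M))"
      then have "x (\<sigma> i) \<in> A i" if "i \<in> I" for i using that by (auto simp: PiE_iff)
      from this[of "inv \<sigma> _"] show "x \<in> PiE I ?A'"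
        using x by (auto simp: space_PiM PiE_iff inv_in permutes_inverses[OF \<sigma>])
    next
      fix x assume x: "x \<in> PiE I ?A'"
      have "x (\<sigma> i) \<in> A i" if "i \<in> I" for i
        using PiE_mem[OF x, of "\<sigma> i"] that by (simp add: in_I permutes_inverses[OF \<sigma>])
      then show "x \<in> (\<lambda>x. \<lambda>i\<in>I. x (\<sigma> i)) -` PiE I A \<inter> space (PiM I (\<lambda>_. M))"
        using x A[THEN sets.sets_into_space] inv_in by (fastforce simp: space_PiM PiE_iff)
    qed
    then have "emeasure (distr (PiM I (\<lambda>_. M)) (PiM I (\<lambda>_. M)) (\<lambda>x. \<lambda>i\<in>I. x (\<sigma> i))) (PiE I A)
        = emeasure (PiM I (\<lambda>_. M)) (PiE I ?A')"
      by (subst emeasure_distr[OF meas]) (auto intro!: sets_PiM_I_finite fin A)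
    also have "\<dots> = (\<Prod>i\<in>I. emeasure M (?A' i))"
      by (rule emeasure_PiM[OF fin]) (simp add: A inv_in)
    also have "\<dots> = (\<Prod>i\<in>I. emeasure M (A i))"
      using prod.permute[OF permutes_inv[OF \<sigma>], of "\<lambda>i. emeasure M (A i)"] by (simp add: comp_def)
    finally show "emeasure (distr (PiM I (\<lambda>_. M)) (PiM I (\<lambda>_. M)) (\<lambda>x. \<lambda>i\<in>I. x (\<sigma> i))) (PiE I A)
        = (\<Prod>i\<in>I. emeasure M (A i))" .
  qed simp
qed

text \<open>This makes the potential symmetric in the particles. The permutation maps the indices
  that the relabelled configuration sends into \<open>A\<close> bijectively onto those that
  \<open>x\<close> sends there.\<close>

lemma empirical_permute:
  assumes \<sigma>: "\<sigma> permutes {..<N}" and x: "x \<in> space (lebN g N)"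
  shows "empirical g N (\<lambda>i\<in>{..<N}. x (\<sigma> i)) = empirical g N x"
proof -
  let ?y = "\<lambda>i\<in>{..<N}. x (\<sigma> i)"
  have in_I: "\<sigma> i < N \<longleftrightarrow> i < N" for i using permutes_in_image[OF \<sigma>] by simp
  have x_in: "x i \<in> states g" if "i < N" for i
    using x that by (auto simp: lebN_def space_PiM PiE_iff)
  have m: "x \<in> uniform_count_measure {..<N} \<rightarrow>\<^sub>M leb g" "?y \<in> uniform_count_measure {..<N} \<rightarrow>\<^sub>M leb g"
    unfolding measurable_cong_sets[OF sets_uniform_count_measure_count_space refl]
    using x_in by (auto simp: in_I)
  show ?thesis
    unfolding empirical_def
  proof (rule measure_eqI)
    fix A assume "A \<in> sets (distr (uniform_count_measure {..<N}) (leb g) ?y)"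
    then have A: "A \<in> sets (leb g)" by simp
    have "\<sigma> ` (?y -` A \<inter> {..<N}) = x -` A \<inter> {..<N}"
    proof (intro set_eqI iffI)
      fix j assume j: "j \<in> x -` A \<inter> {..<N}"
      have "\<sigma> (inv \<sigma> j) = j" by (rule permutes_inverses(1)[OF \<sigma>])
      then have "inv \<sigma> j \<in> ?y -` A \<inter> {..<N}" "j = \<sigma> (inv \<sigma> j)"
        using j in_I[of "inv \<sigma> j"] by simp_all
      then show "j \<in> \<sigma> ` (?y -` A \<inter> {..<N})" by (rule rev_image_eqI)
    qed (auto simp: in_I)
    then have "bij_betw \<sigma> (?y -` A \<inter> {..<N}) (x -` A \<inter> {..<N})"
      using inj_on_subset[OF permutes_inj[OF \<sigma>] subset_UNIV] by (simp add: bij_betw_def)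
    then have "card (?y -` A \<inter> {..<N}) = card (x -` A \<inter> {..<N})"
      by (rule bij_betw_same_card)
    then show "emeasure (distr (uniform_count_measure {..<N}) (leb g) ?y) A =
        emeasure (distr (uniform_count_measure {..<N}) (leb g) x) A"
      by (simp add: emeasure_distr m A space_uniform_count_measure emeasure_uniform_count_measure)
  qed simp
qed

section \<open>Normalization and exchangeability of the Gibbs measure\<close>

context
  fixes g :: geometry and F :: "(real ^ 'd::finite) measure \<Rightarrow> real" and N :: nat
  assumes exp_int: "integrable (lebN g N) (\<lambda>x. exp (- potential g F N x))"
begin

lemma sets_gibbs [simp]: "sets (gibbs g F N) = sets (lebN g N)"
  by (simp add: gibbs_def)

lemma prob_space_gibbs: "prob_space (gibbs g F N)"
proof
  let ?w = "\<lambda>x. exp (- potential g F N x)" and ?L = "lebN g N :: (nat \<Rightarrow> real ^ 'd) measure"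
  let ?Z = "\<integral>y. ?w y \<partial>?L"
  interpret product_sigma_finite "\<lambda>_. leb g :: (real ^ 'd) measure"
    by (simp add: product_sigma_finite_def sigma_finite_leb)
  have "emeasure ?L (space ?L) = (\<Prod>i<N. emeasure (leb g :: (real ^ 'd) measure) (states g))"
    unfolding lebN_def space_PiM space_leb
    by (rule emeasure_PiM) (use sets.top[of "leb g :: (real ^ 'd) measure"] in simp_all)
  then have L: "emeasure ?L (space ?L) \<noteq> 0"
    by (simp add: emeasure_leb_states)
  \<comment> \<open>Division by 0 yields 0, so \<open>?Z = 0\<close> would turn the Gibbs measure
    into the zero measure. It is excluded because the weight is positive everywhere and
    \<open>?L\<close> is not null.\<close>
  have "?Z \<noteq> 0"
  proof
    assume "?Z = 0"
    then have "AE x in ?L. ?w x = 0"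
      using integral_nonneg_eq_0_iff_AE[OF exp_int] by simp
    then have "AE x in ?L. False" by simp
    then show False using L by (simp add: trivial_limit_def[symmetric] ae_filter_eq_bot_iff)
  qed
  then have Z: "?Z > 0"
    by (simp add: order_less_le)
  have "emeasure (gibbs g F N) (space (gibbs g F N)) = (\<integral>\<^sup>+x. ennreal (?w x / ?Z) \<partial>?L)"
    using exp_int unfolding gibbs_def
    by (subst emeasure_density) (auto intro!: nn_integral_cong)
  also have "\<dots> = ennreal (\<integral>x. ?w x / ?Z \<partial>?L)"
    using exp_int Z by (intro nn_integral_eq_integral) auto
  also have "\<dots> = 1"
    using Z by simp
  finally show "emeasure (gibbs g F N) (space (gibbs g F N)) = 1" .
qed

text \<open>A change of variables: relabelling alters neither the reference measure
  (\<open>distr_PiM_permute\<close>) nor the weight (\<open>empirical_permute\<close>).\<close>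

lemma integral_gibbs_permute:
  fixes \<phi> :: "(nat \<Rightarrow> real ^ 'd) \<Rightarrow> real"
  assumes \<sigma>: "\<sigma> permutes {..<N}" and \<phi>: "\<phi> \<in> borel_measurable (lebN g N)"
  shows "(\<integral>x. \<phi> (\<lambda>i\<in>{..<N}. x (\<sigma> i)) \<partial>gibbs g F N) = (\<integral>x. \<phi> x \<partial>gibbs g F N)"
proof -
  let ?T = "\<lambda>x::nat \<Rightarrow> real ^ 'd. \<lambda>i\<in>{..<N}. x (\<sigma> i)" and ?L = "lebN g N :: (nat \<Rightarrow> real ^ 'd) measure"
  let ?w = "\<lambda>x. exp (- potential g F N x) / (\<integral>y. exp (- potential g F N y) \<partial>?L)"
  have T: "?T \<in> ?L \<rightarrow>\<^sub>M ?L" unfolding lebN_def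
    by (intro measurable_restrict measurable_component_singleton) (use permutes_in_image[OF \<sigma>] in simp)
  have distr: "distr ?L ?L ?T = ?L" unfolding lebN_def
    by (rule distr_PiM_permute[OF sigma_finite_leb _ \<sigma>]) simp
  have w: "?w \<in> borel_measurable ?L" "AE x in ?L. 0 \<le> ?w x"
    using borel_measurable_integrable[OF exp_int] by auto
  have dens: "(\<integral>x. \<psi> x \<partial>gibbs g F N) = (\<integral>x. ?w x *\<^sub>R \<psi> x \<partial>?L)" if "\<psi> \<in> borel_measurable ?L"
    for \<psi> :: "(nat \<Rightarrow> real ^ 'd) \<Rightarrow> real"
    unfolding gibbs_def by (rule integral_density[OF that w])
  have "(\<integral>x. \<phi> (?T x) \<partial>gibbs g F N) = (\<integral>x. ?w x *\<^sub>R \<phi> (?T x) \<partial>?L)"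
    by (rule dens) (rule measurable_compose[OF T \<phi>])
  also have "\<dots> = (\<integral>x. ?w (?T x) *\<^sub>R \<phi> (?T x) \<partial>?L)"
    by (rule Bochner_Integration.integral_cong) (simp_all add: potential_def empirical_permute[OF \<sigma>])
  also have "\<dots> = (\<integral>x. ?w x *\<^sub>R \<phi> x \<partial>distr ?L ?L ?T)"
    by (rule integral_distr[OF T, symmetric]) (intro borel_measurable_scaleR w(1) \<phi>)
  also have "\<dots> = (\<integral>x. \<phi> x \<partial>gibbs g F N)"
    unfolding distr by (rule dens[OF \<phi>, symmetric])
  finally show ?thesis .
qed

text \<open>Some permutation takes 0, 1 to \<open>i\<close>, \<open>j\<close>, so a single pair
  marginal serves all off-diagonal terms.\<close>

lemma integral_gibbs_pair:
  fixes u :: "real ^ 'd \<Rightarrow> real"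
  assumes u: "u \<in> borel_measurable (leb g)" and ij: "i < N" "j < N" "i \<noteq> j"
  shows "(\<integral>x. u (x i) * u (x j) \<partial>gibbs g F N) =
    (\<integral>(y, z). u y * u z \<partial>pair_marginal g (gibbs g F N))"
proof -
  \<comment> \<open>The swap of 0 and \<open>i\<close> sends \<open>k\<close> to \<open>j\<close>,
    so swapping 1 and \<open>k\<close> first gives \<open>\<sigma> 1 = j\<close>; as
    \<open>k\<close> is not 0, also \<open>\<sigma> 0 = i\<close>. This remains right when
    \<open>{0, 1}\<close> and \<open>{i, j}\<close> overlap.\<close>
  define k where "k = Transposition.transpose 0 i j"
  define \<sigma> where "\<sigma> = Transposition.transpose 0 i \<circ> Transposition.transpose 1 k"
  have N: "0 < N" "1 < N" using ij by auto
  have k: "k \<noteq> 0" "k < N" using ij by (auto simp: k_def Transposition.transpose_def)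
  have \<sigma>: "\<sigma> permutes {..<N}"
    unfolding \<sigma>_def using ij k N by (intro permutes_compose permutes_swap_id) auto
  have \<sigma>01: "\<sigma> 0 = i" "\<sigma> 1 = j"
    using k by (simp_all add: \<sigma>_def) (simp add: k_def)
  have coord: "(\<lambda>x. x m) \<in> lebN g N \<rightarrow>\<^sub>M leb g" if "m < N" for m
    unfolding lebN_def by (rule measurable_component_singleton) (use that in simp)
  have uu: "(\<lambda>x. u (x 0) * u (x 1)) \<in> borel_measurable (lebN g N)"
    by (intro borel_measurable_times measurable_compose[OF coord u] N)
  have "(\<integral>x. u (x i) * u (x j) \<partial>gibbs g F N) = (\<integral>x. u (x 0) * u (x 1) \<partial>gibbs g F N)"
    using integral_gibbs_permute[OF \<sigma> uu] N by (simp add: \<sigma>01[unfolded One_nat_def])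
  also have "\<dots> = (\<integral>(y, z). u y * u z \<partial>pair_marginal g (gibbs g F N))"
    unfolding pair_marginal_def
  proof (subst integral_distr)
    show "(\<lambda>y. (y 0, y 1)) \<in> gibbs g F N \<rightarrow>\<^sub>M leb g \<Otimes>\<^sub>M leb g"
      unfolding measurable_cong_sets[OF sets_gibbs refl] by (intro measurable_Pair coord N)
    show "(\<lambda>(y, z). u y * u z) \<in> borel_measurable (leb g \<Otimes>\<^sub>M leb g)"
      using u by measurable
  qed simp
  finally show ?thesis .
qed

lemma prob_space_pair_marginal_gibbs:
  assumes "prob_space (gibbs g F N)" and "2 \<le> N"
  shows "prob_space (pair_marginal g (gibbs g F N))"
proof -
  have coord: "(\<lambda>x. x m) \<in> lebN g N \<rightarrow>\<^sub>M leb g" if "m < N" for m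
    unfolding lebN_def by (rule measurable_component_singleton) (use that in simp)
  show ?thesis
    unfolding pair_marginal_def
    by (rule prob_space.prob_space_distr[OF assms(1)],
        unfold measurable_cong_sets[OF sets_gibbs refl], intro measurable_Pair coord)
      (use assms(2) in auto)
qed

end

section \<open>Total variation and centering\<close>

text \<open>A real supremum dominates its members only over a set bounded above; for probability
  measures and test functions bounded by 1, the number 2 is such a bound.\<close>

lemma TV_upper:
  assumes \<mu>: "prob_space \<mu>" and \<nu>: "prob_space \<nu>" and sets_eq: "sets \<mu> = sets \<nu>"
    and \<phi>: "\<phi> \<in> borel_measurable \<mu>" "\<And>x. x \<in> space \<mu> \<Longrightarrow> \<bar>\<phi> x\<bar> \<le> 1"
  shows "\<bar>(\<integral>x. \<phi> x \<partial>\<mu>) - (\<integral>x. \<phi> x \<partial>\<nu>)\<bar> \<le> TV \<mu> \<nu>"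
  unfolding TV_def
proof (rule cSUP_upper)
  have le1: "\<bar>\<integral>x. \<psi> x \<partial>\<rho>\<bar> \<le> 1"
    if "prob_space \<rho>" "\<psi> \<in> borel_measurable \<rho>" "\<And>x. x \<in> space \<rho> \<Longrightarrow> \<bar>\<psi> x\<bar> \<le> 1" for \<psi> :: "'a \<Rightarrow> real" and \<rho>
  proof -
    interpret prob_space \<rho> by fact
    have "integrable \<rho> \<psi>" using that by (intro integrable_const_bound[of _ 1]) auto
    moreover have "- 1 \<le> \<psi> x \<and> \<psi> x \<le> 1" if "x \<in> space \<rho>" for x
      using \<open>\<And>x. x \<in> space \<rho> \<Longrightarrow> \<bar>\<psi> x\<bar> \<le> 1\<close>[OF that] by linarith
    ultimately have "(\<integral>x. \<psi> x \<partial>\<rho>) \<le> 1" "- 1 \<le> (\<integral>x. \<psi> x \<partial>\<rho>)"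
      by (auto intro!: integral_le_const integral_ge_const)
    then show ?thesis by linarith
  qed
  show "bdd_above ((\<lambda>\<phi> :: 'a \<Rightarrow> real. \<bar>(\<integral>x. \<phi> x \<partial>\<mu>) - (\<integral>x. \<phi> x \<partial>\<nu>)\<bar>) `
      {\<phi> \<in> borel_measurable \<mu>. \<forall>x\<in>space \<mu>. \<bar>\<phi> x\<bar> \<le> 1})"
  proof (rule bdd_aboveI2[where M = 2])
    fix \<psi> :: "'a \<Rightarrow> real"
    assume "\<psi> \<in> {\<phi> \<in> borel_measurable \<mu>. \<forall>x\<in>space \<mu>. \<bar>\<phi> x\<bar> \<le> 1}"
    then have "\<bar>\<integral>x. \<psi> x \<partial>\<mu>\<bar> \<le> 1" "\<bar>\<integral>x. \<psi> x \<partial>\<nu>\<bar> \<le> 1"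
      using sets_eq sets_eq_imp_space_eq[OF sets_eq]
      by (auto intro!: le1 \<mu> \<nu> simp: measurable_cong_sets[OF sets_eq refl])
    then show "\<bar>(\<integral>x. \<psi> x \<partial>\<mu>) - (\<integral>x. \<psi> x \<partial>\<nu>)\<bar> \<le> 2" by linarith
  qed
qed (use \<phi> in auto)

lemma quadratic_risk_eq:
  assumes "1 \<le> N"
  shows "quadratic_risk N f \<mu> ms = (\<integral>x. (\<Sum>i<N. f (x i) - (\<integral>y. f y \<partial>ms))\<^sup>2 \<partial>\<mu>) / (real N)\<^sup>2"
proof -
  have "(\<Sum>i<N. f (x i)) / real N - (\<integral>y. f y \<partial>ms) = (\<Sum>i<N. f (x i) - (\<integral>y. f y \<partial>ms)) / real N" for x
    using assms by (simp add: sum_subtractf field_simps)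
  then show ?thesis
    unfolding quadratic_risk_def by (simp add: power_divide)
qed

lemma integral_pair_centered:
  fixes u :: "'a \<Rightarrow> real"
  assumes M: "prob_space M" and u: "u \<in> borel_measurable M" "\<And>x. x \<in> space M \<Longrightarrow> \<bar>u x\<bar> \<le> b"
    and mean: "(\<integral>x. u x \<partial>M) = 0"
  shows "(\<integral>(y, z). u y * u z \<partial>(M \<Otimes>\<^sub>M M)) = 0"
proof -
  interpret prob_space M by fact
  interpret P: pair_prob_space M M ..
  have "integrable (M \<Otimes>\<^sub>M M) (\<lambda>(y, z). u y * u z)"
  proof (rule P.integrable_const_bound[of _ "b * b"])
    show "AE x in M \<Otimes>\<^sub>M M. norm (case x of (y, z) \<Rightarrow> u y * u z) \<le> b * b"
    proof (rule AE_I2)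
      fix x assume "x \<in> space (M \<Otimes>\<^sub>M M)"
      then show "norm (case x of (y, z) \<Rightarrow> u y * u z) \<le> b * b"
        by (auto simp: space_pair_measure abs_mult intro!: mult_mono' u(2))
    qed
  qed (use u(1) in measurable)
  from P.integral_fst[OF this] show ?thesis
    by (simp add: mean)
qed

section \<open>Risk bounds for the chain\<close>

theorem proposition4:
  fixes g :: geometry
    and F :: "(real ^ 'd::finite) measure \<Rightarrow> real"
    and U :: "(real ^ 'd) measure \<Rightarrow> real ^ 'd \<Rightarrow> real"
    and mu_star :: "(real ^ 'd) measure"
    and \<gamma> h :: real
    and N n :: nat
    and \<nu>\<^sub>0 :: "((nat \<Rightarrow> real ^ 'd) \<times> (nat \<Rightarrow> real ^ 'd)) measure"
    and f :: "real ^ 'd \<Rightarrow> real"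
  assumes derivative: "linear_derivative g F U"
    and minimizer: "is_arg_min (free_energy g F) (\<lambda>\<mu>. \<mu> \<in> P2 g) mu_star"
    and unique: "\<And>\<mu>. is_arg_min (free_energy g F) (\<lambda>\<mu>. \<mu> \<in> P2 g) \<mu> \<Longrightarrow> \<mu> = mu_star"
    and self_consistent:
      "\<exists>c>0. mu_star = density (leb g) (\<lambda>x. ennreal (c * exp (- U mu_star x)))"
    and differentiable:
      "\<And>M x. 1 \<le> M \<Longrightarrow> \<exists>D. has_gradient M (lift_potential g F M) D x"
    and exp_integrable:
      "\<And>M. 1 \<le> M \<Longrightarrow> integrable (lebN g M) (\<lambda>x. exp (- potential g F M x))"
    and friction: "0 < \<gamma>" and step_size: "0 < h" "h < inverse \<gamma>"
    and N_pos: "1 \<le> N"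
    and init: "\<nu>\<^sub>0 \<in> P2_phase g N" and init_exchangeable: "exchangeable g N \<nu>\<^sub>0"
    and position_moment: "\<And>k. position_law g F \<gamma> h N \<nu>\<^sub>0 k \<in> P2N g N"
    and f_measurable: "f \<in> borel_measurable (leb g)"
    and f_bounded: "bounded (f ` states g)"
  shows
    "(2 \<le> N \<longrightarrow>
        ereal (quadratic_risk N f (position_law g F \<gamma> h N \<nu>\<^sub>0 n) mu_star) \<le>
        ereal (4 * (sup_norm g f)\<^sup>2) *
          (ereal (1 / real N)
           + esqrt (2 * rel_entropy (position_law g F \<gamma> h N \<nu>\<^sub>0 n) (gibbs g F N))
           + ereal (TV (pair_marginal g (gibbs g F N)) (mu_star \<Otimes>\<^sub>M mu_star)))) \<and>
     (\<forall>R \<eta>. 0 < R \<and> (\<forall>M. 0 \<le> \<eta> M) \<and>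
        (\<forall>M\<ge>1. \<forall>\<mu>\<in>P2N g M.
           rel_entropy \<mu> (Pi\<^sub>M {..<M} (\<lambda>_. mu_star)) \<le>
             ereal R * rel_entropy \<mu> (gibbs g F M) + ereal (\<eta> M)) \<longrightarrow>
        ereal (quadratic_risk N f (position_law g F \<gamma> h N \<nu>\<^sub>0 n) mu_star) \<le>
        ereal (4 * (sup_norm g f)\<^sup>2) *
          (ereal (1 / real N)
           + 2 * esqrt ((ereal (\<eta> N)
               + ereal R * rel_entropy (position_law g F \<gamma> h N \<nu>\<^sub>0 n) (gibbs g F N))
               / ereal (real N))))"
proof -
  define \<mu> where "\<mu> = position_law g F \<gamma> h N \<nu>\<^sub>0 n"
  define S where "S = sup_norm g f"
  define m where "m = (\<integral>y. f y \<partial>mu_star)"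
  define u where "u y = f y - m" for y
  have "\<mu> \<in> P2N g N" unfolding \<mu>_def by (rule position_moment)
  then have \<mu>: "prob_space \<mu>" and sets_\<mu>: "sets \<mu> = sets (lebN g N)" by (auto simp: P2N_def)
  interpret \<mu>: prob_space \<mu> by fact
  have "mu_star \<in> P2 g" using minimizer by (simp add: is_arg_min_def)
  then have ms: "prob_space mu_star" and sets_ms: "sets mu_star = sets (leb g)" by (auto simp: P2_def)
  interpret ms: prob_space mu_star by fact
  have space_ms: "space mu_star = states g" using sets_eq_imp_space_eq[OF sets_ms] by simp
  have sets_prod: "sets (lebN g N) = sets (PiM {..<N} (\<lambda>_. mu_star))"
    unfolding lebN_def by (rule sets_PiM_cong) (simp_all add: sets_ms)
  let ?G = "gibbs g F N"
  note exp_int = exp_integrable[OF N_pos]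
  have G: "prob_space ?G" by (rule prob_space_gibbs[OF exp_int])
  interpret G: prob_space ?G by fact
  have sets_G: "sets \<mu> = sets ?G" by (simp add: sets_gibbs[OF exp_int] sets_\<mu>)

  have fS: "\<bar>f y\<bar> \<le> S" if "y \<in> states g" for y
    unfolding S_def sup_norm_def
    using f_bounded that by (intro cSUP_upper) (auto simp: bounded_iff bdd_above_def)
  have f_ms: "f \<in> borel_measurable mu_star"
    using f_measurable by (simp add: measurable_cong_sets[OF sets_ms refl])
  have intf: "integrable mu_star f"
    using f_ms fS by (intro ms.integrable_const_bound[of _ S]) (auto simp: space_ms)
  have "\<bar>m\<bar> \<le> S"
  proof -
    have "- S \<le> f y \<and> f y \<le> S" if "y \<in> states g" for y using fS[OF that] by linarith
    then have "m \<le> S" "- S \<le> m"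
      unfolding m_def using intf
      by (auto intro!: ms.integral_le_const ms.integral_ge_const simp: space_ms)
    then show ?thesis by linarith
  qed
  then have uS: "\<bar>u y\<bar> \<le> 2 * S" if "y \<in> states g" for y
    using fS[OF that] unfolding u_def by linarith
  have S: "0 \<le> S" using \<open>\<bar>m\<bar> \<le> S\<close> by linarith
  have u_leb: "u \<in> borel_measurable (leb g)" unfolding u_def using f_measurable by measurable
  have u_ms: "u \<in> borel_measurable mu_star" unfolding u_def using f_ms by measurable
  have u_mean: "ms.expectation u = 0"
    unfolding u_def using intf by (simp add: m_def ms.prob_space)
  \<comment> \<open>As \<open>u\<close> is bounded by \<open>2 * S\<close> on the state space,
    \<open>a\<close> bounds every product \<open>u (x i) * u (x j)\<close>. It is the prefactor of
    both claims.\<close>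
  define a where "a = 4 * S\<^sup>2"
  have a: "a = (2 * S)\<^sup>2" "0 \<le> a" by (simp_all add: a_def)

  define risk where "risk = quadratic_risk N f \<mu> mu_star"
  define \<Phi> where "\<Phi> x = (\<Sum>i<N. u (x i))\<^sup>2" for x
  have risk: "risk = (\<integral>x. \<Phi> x \<partial>\<mu>) / (real N)\<^sup>2"
    unfolding risk_def \<Phi>_def u_def m_def by (rule quadratic_risk_eq[OF N_pos])
  have in_states: "x i \<in> states g" if "x \<in> space (lebN g N)" "i < N" for x i
    using that by (auto simp: lebN_def space_PiM PiE_iff)
  have \<Phi>_le: "\<bar>\<Phi> x\<bar> \<le> (real N)\<^sup>2 * a" if "x \<in> space (lebN g N)" for x
  proof -
    have "\<bar>\<Sum>i<N. u (x i)\<bar> \<le> (\<Sum>i<N. 2 * S)"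
      using in_states[OF that] by (intro order_trans[OF sum_abs] sum_mono uS) auto
    then have "\<bar>\<Sum>i<N. u (x i)\<bar>\<^sup>2 \<le> (real N * (2 * S))\<^sup>2"
      by (intro power_mono) auto
    then show ?thesis by (simp add: \<Phi>_def a power_mult_distrib)
  qed
  have u_coord: "(\<lambda>x. u (x i)) \<in> borel_measurable (lebN g N)" if "i < N" for i
    unfolding lebN_def
    by (rule measurable_compose[OF _ u_leb], rule measurable_component_singleton) (use that in simp)
  have \<Phi>_meas: "\<Phi> \<in> borel_measurable (lebN g N)"
    unfolding \<Phi>_def by (intro borel_measurable_power borel_measurable_sum u_coord) auto
  have space_\<mu>: "space \<mu> = space (lebN g N)" by (rule sets_eq_imp_space_eq[OF sets_\<mu>])
  have N: "0 < real N" using N_pos by simp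

  \<comment> \<open>This trivial bound settles infinite entropy. In \<open>ereal\<close>,
    \<open>0 * \<infinity> = 0\<close>, so for \<open>a = 0\<close> the right-hand side is 0 and
    \<open>risk <= 0\<close> has to be known.\<close>
  have risk_le: "risk \<le> a"
  proof -
    have "integrable \<mu> \<Phi>"
      using \<Phi>_le \<Phi>_meas
      by (intro \<mu>.integrable_const_bound[of _ "(real N)\<^sup>2 * a"])
        (auto simp: space_\<mu> measurable_cong_sets[OF sets_\<mu> refl])
    moreover have "\<Phi> x \<le> (real N)\<^sup>2 * a" if "x \<in> space \<mu>" for x
      using \<Phi>_le[of x] that by (simp add: space_\<mu>)
    ultimately have "(\<integral>x. \<Phi> x \<partial>\<mu>) \<le> (real N)\<^sup>2 * a"
      by (intro \<mu>.integral_le_const) auto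
    then show ?thesis unfolding risk using N by (simp add: field_simps)
  qed
  have infinite: "ereal risk \<le> ereal a * \<infinity>"
    using risk_le a(2) by (cases "a = 0") (auto simp: zero_ereal_def)

  have part1: "risk \<le> a * (1 / real N + sqrt (2 * H) + TV (pair_marginal g ?G) (mu_star \<Otimes>\<^sub>M mu_star))"
    if "2 \<le> N" and ent: "rel_entropy \<mu> ?G = ereal H" for H
  proof -
    define T where "T = TV (pair_marginal g ?G) (mu_star \<Otimes>\<^sub>M mu_star)"
    interpret PP: pair_prob_space mu_star mu_star ..
    have PM: "prob_space (pair_marginal g ?G)"
      by (rule prob_space_pair_marginal_gibbs[OF exp_int G \<open>2 \<le> N\<close>])
    have sets_PM: "sets (pair_marginal g ?G) = sets (mu_star \<Otimes>\<^sub>M mu_star)"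
      by (simp add: pair_marginal_def sets_ms cong: sets_pair_measure_cong)
    have T_upper: "\<bar>(\<integral>x. \<phi> x \<partial>pair_marginal g ?G) - (\<integral>x. \<phi> x \<partial>(mu_star \<Otimes>\<^sub>M mu_star))\<bar> \<le> T"
      if "\<phi> \<in> borel_measurable (mu_star \<Otimes>\<^sub>M mu_star)"
        "\<And>x. x \<in> space (mu_star \<Otimes>\<^sub>M mu_star) \<Longrightarrow> \<bar>\<phi> x\<bar> \<le> 1" for \<phi>
      unfolding T_def using that
      by (intro TV_upper PM PP.prob_space_axioms sets_PM)
        (auto simp: measurable_cong_sets[OF sets_PM refl] sets_eq_imp_space_eq[OF sets_PM])
    have "0 \<le> T" using T_upper[of "\<lambda>_. 0"] by simp
    define I where "I = (\<integral>(y, z). u y * u z \<partial>pair_marginal g ?G)"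
    have I_le: "I \<le> a * T"
    \<comment> \<open>The test function for \<open>T\<close> is divided by \<open>a\<close>; if
      \<open>a = 0\<close>, then \<open>u\<close> vanishes on the state space.\<close>
    proof (cases "a = 0")
      case True
      then have "u y = 0" if "y \<in> states g" for y
        using uS[OF that] by (simp add: a_def)
      then have "I = (\<integral>x. 0 \<partial>pair_marginal g ?G)"
        unfolding I_def
        by (intro Bochner_Integration.integral_cong refl)
          (auto simp: pair_marginal_def space_pair_measure)
      then show ?thesis using True by simp
    next
      case False
      then have "0 < a" using a(2) by simp
      \<comment> \<open>After division by \<open>a\<close> the product is an admissible test
        function. Its mean under two independent copies of \<open>mu_star\<close> is 0, so
        \<open>T\<close> controls \<open>I\<close> itself.\<close>
      have "\<bar>(\<integral>x. (case x of (y, z) \<Rightarrow> u y * u z) / a \<partial>pair_marginal g ?G) -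
          (\<integral>x. (case x of (y, z) \<Rightarrow> u y * u z) / a \<partial>(mu_star \<Otimes>\<^sub>M mu_star))\<bar> \<le> T"
      proof (rule T_upper)
        show "(\<lambda>x. (case x of (y, z) \<Rightarrow> u y * u z) / a) \<in> borel_measurable (mu_star \<Otimes>\<^sub>M mu_star)"
          using u_ms by measurable
        fix x assume "x \<in> space (mu_star \<Otimes>\<^sub>M mu_star)"
        then obtain y z where x: "x = (y, z)" "y \<in> states g" "z \<in> states g"
          by (auto simp: space_pair_measure space_ms)
        have "\<bar>u y\<bar> * \<bar>u z\<bar> \<le> a"
          unfolding a(1) power2_eq_square by (intro mult_mono' uS x) auto
        then show "\<bar>(case x of (y, z) \<Rightarrow> u y * u z) / a\<bar> \<le> 1"
          using \<open>0 < a\<close> by (simp add: x(1) abs_mult)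
      qed
      moreover have "(\<integral>(y, z). u y * u z \<partial>(mu_star \<Otimes>\<^sub>M mu_star)) = 0"
        by (rule integral_pair_centered[OF ms u_ms _ u_mean]) (use uS in \<open>simp add: space_ms\<close>)
      ultimately have "\<bar>I\<bar> / a \<le> T" using \<open>0 < a\<close> by (simp add: I_def)
      then have "\<bar>I\<bar> \<le> a * T" using \<open>0 < a\<close> by (simp add: pos_divide_le_eq mult.commute)
      then show ?thesis by linarith
    qed
    have G_meas: "\<psi> \<in> borel_measurable ?G" if "\<psi> \<in> borel_measurable (lebN g N)" for \<psi> :: "_ \<Rightarrow> real"
      using that by (simp add: measurable_cong_sets[OF sets_gibbs[OF exp_int] refl])
    have space_G: "space ?G = space (lebN g N)"
      by (rule sets_eq_imp_space_eq[OF sets_gibbs[OF exp_int]])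
    have uu: "\<bar>u (x i) * u (x j)\<bar> \<le> a" if "x \<in> space ?G" "i < N" "j < N" for x i j
      unfolding a(1) abs_mult power2_eq_square
      using that by (intro mult_mono' uS in_states) (auto simp: space_G)
    have int: "integrable ?G (\<lambda>x. u (x i) * u (x j))" if "i < N" "j < N" for i j
      using uu that
      by (intro G.integrable_const_bound[of _ a] G_meas borel_measurable_times u_coord AE_I2) auto
    have "(\<integral>x. \<Phi> x \<partial>?G) =
        (\<integral>x. (\<Sum>i<N. \<Sum>j<N. u (x i) * u (x j)) \<partial>?G)"
      by (simp add: \<Phi>_def power2_eq_square sum_product)
    also have "\<dots> = (\<Sum>i<N. \<Sum>j<N. (\<integral>x. u (x i) * u (x j) \<partial>?G))"
      using int by (subst Bochner_Integration.integral_sum) (auto intro!: sum.cong Bochner_Integration.integral_sum)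
    \<comment> \<open>Adding \<open>a * T\<close> on the diagonal too is harmless as
      \<open>0 <= T\<close>, and it gives the count \<open>N^2\<close> in place of
      \<open>N * (N - 1)\<close>.\<close>
    also have "\<dots> \<le> (\<Sum>i<N. \<Sum>j<N. (if i = j then a else 0) + a * T)"
    proof (intro sum_mono)
      fix i j assume ij: "i \<in> {..<N}" "j \<in> {..<N}"
      show "(\<integral>x. u (x i) * u (x j) \<partial>?G) \<le> (if i = j then a else 0) + a * T"
      proof (cases "i = j")
        case True
        have "(\<integral>x. u (x i) * u (x j) \<partial>?G) \<le> a"
          using ij by (intro G.integral_le_const int AE_I2 order_trans[OF abs_ge_self uu]) auto
        also have "\<dots> \<le> a + a * T" using a(2) \<open>0 \<le> T\<close> by simp
        finally show ?thesis using True by simp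
      next
        case False
        then show ?thesis
          using integral_gibbs_pair[OF exp_int u_leb, of i j] ij I_le by (simp add: I_def)
      qed
    qed
    also have "\<dots> = real N * a + (real N)\<^sup>2 * (a * T)"
      by (simp add: sum.distrib power2_eq_square algebra_simps)
    finally have Gibbs: "(\<integral>x. \<Phi> x \<partial>?G) \<le> real N * a + (real N)\<^sup>2 * (a * T)" .
    \<comment> \<open>Pinsker is applied to the whole square \<open>\<Phi>\<close>, bounded by
      \<open>N^2 * a\<close>; the factor \<open>N^2\<close> cancels in the risk.\<close>
    have "(\<integral>x. \<Phi> x \<partial>\<mu>) \<le> (\<integral>x. \<Phi> x \<partial>?G) + (real N)\<^sup>2 * a * sqrt (2 * H)"
      using \<Phi>_le a(2) by (intro G.pinsker[OF \<mu> sets_G ent] G_meas \<Phi>_meas) (auto simp: space_G)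
    with Gibbs have "(\<integral>x. \<Phi> x \<partial>\<mu>) \<le> (real N)\<^sup>2 * (a * (1 / real N + sqrt (2 * H) + T))"
      using N by (simp add: algebra_simps power2_eq_square)
    then show ?thesis
      unfolding risk T_def using N by (simp add: divide_le_eq mult.commute)
  qed

  \<comment> \<open>Here \<open>H\<close> is the entropy relative to the product measure; the
    assumed inequality turns it into entropy relative to the Gibbs measure only at the end.\<close>
  have part2: "risk \<le> a * (1 / real N + 2 * sqrt (H / real N))"
    if ent: "rel_entropy \<mu> (PiM {..<N} (\<lambda>_. mu_star)) = ereal H" for H
  proof -
    have "(\<integral>x. \<Phi> x \<partial>\<mu>) \<le> real N * a + 2 * real N * a * sqrt (real N * H)"
      unfolding \<Phi>_def a(1)
      by (rule ms.chaos_second_moment[OF u_ms _ u_mean \<mu> _ ent])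
        (use uS in \<open>auto simp: space_ms sets_\<mu> sets_prod\<close>)
    also have "sqrt (real N * H) = real N * sqrt (H / real N)"
      using N by (simp add: real_sqrt_mult real_sqrt_divide field_simps)
    also have "real N * a + 2 * real N * a * (real N * sqrt (H / real N)) =
        (real N)\<^sup>2 * (a * (1 / real N + 2 * sqrt (H / real N)))"
      using N by (simp add: algebra_simps power2_eq_square)
    finally show ?thesis
      unfolding risk using N by (simp add: divide_le_eq mult.commute)
  qed

  have "ereal risk \<le> ereal a * (ereal (1 / real N) + esqrt (2 * rel_entropy \<mu> ?G)
      + ereal (TV (pair_marginal g ?G) (mu_star \<Otimes>\<^sub>M mu_star)))" if "2 \<le> N"
  proof (cases "rel_entropy \<mu> ?G = \<infinity>")
    case True
    then show ?thesis using infinite by (simp add: esqrt_def)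
  next
    case False
    then obtain H where H: "rel_entropy \<mu> ?G = ereal H" by (auto simp: rel_entropy_def split: if_splits)
    have "esqrt (2 * rel_entropy \<mu> ?G) = ereal (sqrt (2 * H))"
      by (simp add: H esqrt_def)
    then show ?thesis using part1[OF that H] by simp
  qed
  moreover have "ereal risk \<le> ereal a * (ereal (1 / real N)
      + 2 * esqrt ((ereal (\<eta> N) + ereal R * rel_entropy \<mu> ?G) / ereal (real N)))"
    if "0 < R" and tensor: "\<forall>M\<ge>1. \<forall>\<mu>\<in>P2N g M. rel_entropy \<mu> (Pi\<^sub>M {..<M} (\<lambda>_. mu_star)) \<le>
             ereal R * rel_entropy \<mu> (gibbs g F M) + ereal (\<eta> M)" for R \<eta>
  proof (cases "rel_entropy \<mu> ?G = \<infinity>")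
    case True
    \<comment> \<open>With \<open>0 < R\<close> the product \<open>R * \<infinity>\<close> is
      \<infinity> and not 0, so the right-hand side is again \<open>a * \<infinity>\<close>.\<close>
    then show ?thesis using infinite \<open>0 < R\<close> N by (simp add: esqrt_def)
  next
    case False
    then obtain H where H: "rel_entropy \<mu> ?G = ereal H" by (auto simp: rel_entropy_def split: if_splits)
    have le: "rel_entropy \<mu> (Pi\<^sub>M {..<N} (\<lambda>_. mu_star)) \<le> ereal (R * H + \<eta> N)"
      using tensor N_pos \<open>\<mu> \<in> P2N g N\<close> H by fastforce
    \<comment> \<open>By definition \<open>rel_entropy\<close> is either a real or \<infinity>, and
      the finite bound \<open>le\<close> excludes \<infinity>.\<close>
    then obtain H' where H': "rel_entropy \<mu> (Pi\<^sub>M {..<N} (\<lambda>_. mu_star)) = ereal H'"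
      by (auto simp: rel_entropy_def split: if_splits)
    have "H' \<le> \<eta> N + R * H" using le H' by simp
    then have "sqrt (H' / real N) \<le> sqrt ((\<eta> N + R * H) / real N)"
      by (intro real_sqrt_le_mono divide_right_mono) auto
    then have "a * (1 / real N + 2 * sqrt (H' / real N)) \<le>
        a * (1 / real N + 2 * sqrt ((\<eta> N + R * H) / real N))"
      using a(2) by (intro mult_left_mono) auto
    with part2[OF H'] have "risk \<le> a * (1 / real N + 2 * sqrt ((\<eta> N + R * H) / real N))"
      by linarith
    moreover have "esqrt ((ereal (\<eta> N) + ereal R * rel_entropy \<mu> ?G) / ereal (real N)) =
        ereal (sqrt ((\<eta> N + R * H) / real N))"
      using N by (simp add: H esqrt_def)
    ultimately show ?thesis by simp
  qed
  ultimately show ?thesis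
    unfolding risk_def \<mu>_def a_def S_def by blast
qed

end
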